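(* Let $n\ge 1$ and $1\le k\le n$ be integers and let $d$ be any integer. Then \[ \left\langle {n \atop d} \right\rangle_k = \sum_{j\ge 0} (-1)^{d-j} \binom{n}{d-j}\, j^{k-1}(j+1)^{n-k}, \] where $0^0$ is interpreted as $1$.
   Context: $S_n$ is the set of permutations of $\{1,\dots,n\}$, and a permutation $\pi$ is identified with the sequence $\pi(1),\dots,\pi(n)$. A descent of $\pi$ is an index $i$ with $1\le i\le n-1$ and $\pi(i)>\pi(i+1)$; $\mathrm{Des}(\pi)$ denotes the number of descents. For integers $n,d,k$, $\left\langle {n \atop d} \right\rangle_k$ denotes the number of $\pi\in S_n$ with $\mathrm{Des}(\pi)=d$ and $\pi(1)=k$ (this is $0$ if no such permutation exists, e.g. if $d<0$ or $d\ge n$). Binomial coefficients $\binom{n}{m}$ are $0$ for $m<0$ or $m>n$, so the sum is finite. *)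

theory Defs
  imports Complex_Main "HOL-Combinatorics.Permutations"
begin

definition Des :: "nat \<Rightarrow> (nat \<Rightarrow> nat) \<Rightarrow> nat" where
  "Des n \<pi> = card {i \<in> {1..n - 1}. \<pi> i > \<pi> (i + 1)}"

definition eulerian_first :: "nat \<Rightarrow> int \<Rightarrow> nat \<Rightarrow> nat" where
  "eulerian_first n d k =
     card {\<pi>. \<pi> permutes {1..n} \<and> int (Des n \<pi>) = d \<and> \<pi> 1 = k}"

text \<open>The lower index may be any integer; the coefficient vanishes outside \<open>0 \<le> m \<le> n\<close>.\<close>

definition int_choose :: "nat \<Rightarrow> int \<Rightarrow> nat" where
  "int_choose n m = (if m < 0 then 0 else n choose nat m)"

end

theory Submission
  imports Defs "HOL-Computational_Algebra.Formal_Power_Series"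
begin

unbundle fps_syntax

text \<open>
  Deleting the first entry \<open>k\<close> of a permutation of \<open>{1..n + 1}\<close> and standardising yields a
  permutation of \<open>{1..n}\<close> with first entry \<open>l\<close>, and a descent is lost precisely when \<open>l < k\<close>.
  Hence the generating functions \<open>E n k\<close> of descents satisfy
  \<open>E (n + 1) k = X * (\<Sum>l<k. E n l) + (\<Sum>l\<ge>k. E n l)\<close>. With
  \<open>P n k = (\<Sum>j. j ^ (k - 1) * (j + 1) ^ (n - k) * X ^ j)\<close>, the series \<open>(1 - X) ^ n * P n k\<close> obey
  the same recurrence, because \<open>P n l = P (n + 1) l - P (n + 1) (l + 1)\<close> makes both sums telescope.
\<close>

section \<open>Inserting a first entry into a permutation\<close>

text \<open>The increasing bijection from the naturals onto the naturals other than
  \<open>k\<close>: the inverse of standardising after \<open>k\<close> has been deleted.\<close>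

definition skip :: "nat \<Rightarrow> nat \<Rightarrow> nat" where
  "skip k v = (if v < k then v else Suc v)"

lemma skip_less_iff [simp]: "skip k u < skip k v \<longleftrightarrow> u < v"
  by (auto simp: skip_def)

lemma skip_eq_iff [simp]: "skip k u = skip k v \<longleftrightarrow> u = v"
  by (auto simp: skip_def)

lemma skip_neq [simp]: "skip k v \<noteq> k" "k \<noteq> skip k v"
  by (auto simp: skip_def)

text \<open>The inverse of deleting the first entry. It fixes all points outside
  \<open>{1..Suc n}\<close>, as \<open>permutes\<close> demands.\<close>

definition insert_first :: "nat \<Rightarrow> nat \<Rightarrow> (nat \<Rightarrow> nat) \<Rightarrow> nat \<Rightarrow> nat" where
  "insert_first n k \<tau> i =
     (if i = 1 then k else if i \<in> {2..Suc n} then skip k (\<tau> (i - 1)) else i)"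

lemma insert_first_permutes:
  assumes \<tau>: "\<tau> permutes {1..n}" and k: "k \<in> {1..Suc n}"
  shows "insert_first n k \<tau> permutes {1..Suc n}"
proof (rule bij_imp_permutes)
  have inj: "inj_on (insert_first n k \<tau>) {1..Suc n}"
  proof (rule inj_onI)
    fix x y
    assume xy: "x \<in> {1..Suc n}" "y \<in> {1..Suc n}"
      and eq: "insert_first n k \<tau> x = insert_first n k \<tau> y"
    show "x = y"
    proof (cases "x = 1 \<or> y = 1")
      case True
      then show ?thesis
        using xy eq by (auto simp: insert_first_def split: if_splits)
    next
      case False
      then have "\<tau> (x - 1) = \<tau> (y - 1)"
        using xy eq by (auto simp: insert_first_def)
      then have "x - 1 = y - 1"
        using permutes_inj[OF \<tau>] by (meson injD)
      then show ?thesis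
        using xy by auto
    qed
  qed
  have "insert_first n k \<tau> x \<in> {1..Suc n}" if x: "x \<in> {1..Suc n}" for x
  proof (cases "x = 1")
    case False
    then have "\<tau> (x - 1) \<in> {1..n}"
      using x by (subst permutes_in_image[OF \<tau>]) auto
    then show ?thesis
      using x False by (auto simp: insert_first_def skip_def)
  qed (use k in \<open>auto simp: insert_first_def\<close>)
  then have "insert_first n k \<tau> ` {1..Suc n} \<subseteq> {1..Suc n}"
    by blast
  with inj show "bij_betw (insert_first n k \<tau>) {1..Suc n} {1..Suc n}"
    by (simp add: bij_betw_def endo_inj_surj)
qed (use k in \<open>auto simp: insert_first_def\<close>)

lemma insert_first_inj:
  "inj_on (insert_first n k) {\<tau>. \<tau> permutes {1..n}}"
proof (rule inj_onI, rule ext)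
  fix \<tau> \<tau>' i
  assume \<tau>: "\<tau> \<in> {\<tau>. \<tau> permutes {1..n}}" "\<tau>' \<in> {\<tau>. \<tau> permutes {1..n}}"
    and eq: "insert_first n k \<tau> = insert_first n k \<tau>'"
  show "\<tau> i = \<tau>' i"
  proof (cases "i \<in> {1..n}")
    case True
    then show ?thesis
      using fun_cong[OF eq, of "Suc i"] by (simp add: insert_first_def)
  next
    case False
    then show ?thesis
      using \<tau> by (simp add: permutes_not_in)
  qed
qed

lemma insert_first_surj:
  assumes \<sigma>: "\<sigma> permutes {1..Suc n}" and k: "\<sigma> 1 = k"
  shows "\<exists>\<tau>. \<tau> permutes {1..n} \<and> insert_first n k \<tau> = \<sigma>"
proof -
  \<comment> \<open>\<open>del\<close> closes the gap at \<open>k\<close>; it undoes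
    \<open>skip k\<close> on every value other than \<open>k\<close>.\<close>
  define del where "del v = (if v < k then v else v - 1)" for v
  define \<tau> where "\<tau> i = (if i \<in> {1..n} then del (\<sigma> (Suc i)) else i)" for i
  have k_range: "k \<in> {1..Suc n}"
    using permutes_in_image[OF \<sigma>, of 1] k by simp
  have ne: "\<sigma> (Suc i) \<noteq> k" if "i \<in> {1..n}" for i
    using that k injD[OF permutes_inj[OF \<sigma>], of "Suc i" 1] by auto
  have range: "\<sigma> (Suc i) \<in> {1..Suc n}" if "i \<in> {1..n}" for i
    using that permutes_in_image[OF \<sigma>, of "Suc i"] by auto
  have skip_\<tau>: "skip k (\<tau> i) = \<sigma> (Suc i)" if "i \<in> {1..n}" for i
    using that ne[OF that] by (auto simp: \<tau>_def del_def skip_def)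
  have "inj_on \<tau> {1..n}"
  proof (rule inj_onI)
    fix x y assume "x \<in> {1..n}" "y \<in> {1..n}" "\<tau> x = \<tau> y"
    then have "\<sigma> (Suc x) = \<sigma> (Suc y)"
      using skip_\<tau> by metis
    then show "x = y"
      using permutes_inj[OF \<sigma>] by (auto dest: injD)
  qed
  moreover have "\<tau> i \<in> {1..n}" if "i \<in> {1..n}" for i
    \<comment> \<open>A value below \<open>k\<close> is at most \<open>n\<close> because
      \<open>k \<le> Suc n\<close>; a value above \<open>k\<close> stays positive after subtracting
      1 because \<open>k \<ge> 1\<close>.\<close>
    using that range[OF that] ne[OF that] k_range by (auto simp: \<tau>_def del_def)
  then have "\<tau> ` {1..n} \<subseteq> {1..n}"
    by blast
  ultimately have "bij_betw \<tau> {1..n} {1..n}"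
    by (simp add: bij_betw_def endo_inj_surj)
  then have "\<tau> permutes {1..n}"
    by (rule bij_imp_permutes) (auto simp: \<tau>_def)
  moreover have "insert_first n k \<tau> = \<sigma>"
  proof
    fix i
    consider "i = 1" | "i \<in> {2..Suc n}" | "i \<notin> {1..Suc n}"
      by force
    then show "insert_first n k \<tau> i = \<sigma> i"
    proof cases
      case 2
      then show ?thesis
        using skip_\<tau>[of "i - 1"] by (cases i) (auto simp: insert_first_def)
    next
      case 3
      then show ?thesis
        using permutes_not_in[OF \<sigma>, of i] by (auto simp: insert_first_def)
    qed (use k in \<open>simp add: insert_first_def\<close>)
  qed
  ultimately show ?thesis
    by blast
qed

text \<open>Since \<open>skip k\<close> is strictly increasing, each descent of
  \<open>\<tau>\<close> survives one place further right. Position 1 is new: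
  \<open>skip k (\<tau> 1)\<close> lies below \<open>k\<close> exactly when \<open>\<tau> 1\<close>
  does.\<close>

lemma Des_insert_first:
  assumes "n \<ge> 1"
  shows "Des (Suc n) (insert_first n k \<tau>) = Des n \<tau> + (if \<tau> 1 < k then 1 else 0)"
proof -
  let ?D = "{i \<in> {1..n - 1}. \<tau> i > \<tau> (i + 1)}"
  let ?D' = "{i \<in> {1..n}. insert_first n k \<tau> i > insert_first n k \<tau> (i + 1)}"
  have "i \<in> ?D' \<longleftrightarrow> i \<in> (if \<tau> 1 < k then {1} else {}) \<union> Suc ` ?D" for i
  proof (cases "i \<le> 1")
    case True
    then have "i = 0 \<or> i = 1"
      by auto
    then show ?thesis
      using assms by (auto simp: insert_first_def skip_def)
  next
    case False
    then obtain m where "i = Suc m" "m \<ge> 1"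
      by (cases i) auto
    then show ?thesis
      by (auto simp: insert_first_def)
  qed
  then have "?D' = (if \<tau> 1 < k then {1} else {}) \<union> Suc ` ?D"
    by blast
  then have "card ?D' = card ((if \<tau> 1 < k then {1} else {}) \<union> Suc ` ?D)"
    by simp
  also have "\<dots> = card (if \<tau> 1 < k then {1::nat} else {}) + card (Suc ` ?D)"
    by (rule card_Un_disjoint) auto
  also have "\<dots> = (if \<tau> 1 < k then 1 else 0) + card ?D"
    by (simp add: card_image)
  finally show ?thesis
    by (simp add: Des_def)
qed

text \<open>The permutations on the left are classified by the first entry \<open>l\<close> of what
  remains after deleting \<open>k\<close>.\<close>

lemma eulerian_first_Suc:
  assumes n: "n \<ge> 1" and k: "k \<in> {1..Suc n}"
  shows "eulerian_first (Suc n) d k =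
    (\<Sum>l=1..n. eulerian_first n (d - (if l < k then 1 else 0)) l)"
proof -
  define A where "A l =
    {\<tau>. \<tau> permutes {1..n} \<and> int (Des n \<tau>) = d - (if l < k then 1 else 0) \<and> \<tau> 1 = l}" for l
  have "{\<sigma>. \<sigma> permutes {1..Suc n} \<and> int (Des (Suc n) \<sigma>) = d \<and> \<sigma> 1 = k} =
      insert_first n k ` (\<Union>l\<in>{1..n}. A l)" (is "?S = _")
  proof (intro equalityI subsetI)
    fix \<sigma> assume \<sigma>: "\<sigma> \<in> ?S"
    then obtain \<tau> where \<tau>: "\<tau> permutes {1..n}" "insert_first n k \<tau> = \<sigma>"
      using insert_first_surj by blast
    then have "\<tau> 1 \<in> {1..n}"
      using n by (subst permutes_in_image[OF \<tau>(1)]) auto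
    moreover have "\<tau> \<in> A (\<tau> 1)"
      using \<sigma> \<tau> Des_insert_first[OF n, of k \<tau>] by (auto simp: A_def)
    ultimately show "\<sigma> \<in> insert_first n k ` (\<Union>l\<in>{1..n}. A l)"
      using \<tau> by blast
  next
    fix \<sigma> assume "\<sigma> \<in> insert_first n k ` (\<Union>l\<in>{1..n}. A l)"
    then obtain \<tau> where "\<sigma> = insert_first n k \<tau>" "\<tau> \<in> A (\<tau> 1)"
      by (auto simp: A_def)
    then show "\<sigma> \<in> ?S"
      using insert_first_permutes[OF _ k, of \<tau>] Des_insert_first[OF n, of k \<tau>]
      by (auto simp: A_def insert_first_def)
  qed
  moreover have "inj_on (insert_first n k) (\<Union>l\<in>{1..n}. A l)"
    by (rule inj_on_subset[OF insert_first_inj]) (auto simp: A_def)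
  moreover have "card (\<Union>l\<in>{1..n}. A l) = (\<Sum>l=1..n. card (A l))"
  proof (rule card_UN_disjoint)
    show "\<forall>l\<in>{1..n}. finite (A l)"
      unfolding A_def by (auto intro: finite_subset[OF _ finite_permutations[of "{1..n}"]])
  qed (auto simp: A_def)
  ultimately show ?thesis
    by (simp add: eulerian_first_def A_def card_image)
qed

section \<open>Boundary values and the generating functions by descents\<close>

lemma eulerian_first_neg: "d < 0 \<Longrightarrow> eulerian_first n d k = 0"
  by (auto simp: eulerian_first_def)

lemma eulerian_first_1: "eulerian_first 1 d 1 = (if d = 0 then 1 else 0)"
proof -
  have "{\<pi>. \<pi> permutes {1..1::nat} \<and> int (Des 1 \<pi>) = d \<and> \<pi> 1 = 1} =
      (if d = 0 then {id} else {})"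
    by (auto simp: Des_def)
  then show ?thesis
    by (simp add: eulerian_first_def)
qed

definition eulerian_fps :: "nat \<Rightarrow> nat \<Rightarrow> real fps" where
  "eulerian_fps n k = Abs_fps (\<lambda>d. real (eulerian_first n (int d) k))"

definition power_fps :: "nat \<Rightarrow> nat \<Rightarrow> real fps" where
  "power_fps n k = Abs_fps (\<lambda>j. real j ^ (k - 1) * (real j + 1) ^ (n - k))"

lemma eulerian_fps_Suc:
  assumes n: "n \<ge> 1" and k: "k \<in> {1..Suc n}"
  shows "eulerian_fps (Suc n) k =
    fps_X * (\<Sum>l=1..<k. eulerian_fps n l) + (\<Sum>l=k..<Suc n. eulerian_fps n l)"
proof (rule fps_ext)
  fix d
  have split: "{1..n} = {1..<k} \<union> {k..<Suc n}"
    using k by auto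
  have "eulerian_first (Suc n) (int d) k =
      (\<Sum>l=1..<k. eulerian_first n (int d - 1) l) + (\<Sum>l=k..<Suc n. eulerian_first n (int d) l)"
    unfolding eulerian_first_Suc[OF n k] split
    by (subst sum.union_disjoint) auto
  then show "eulerian_fps (Suc n) k $ d =
    (fps_X * (\<Sum>l=1..<k. eulerian_fps n l) + (\<Sum>l=k..<Suc n. eulerian_fps n l)) $ d"
    \<comment> \<open>At \<open>d = 0\<close> the first sum has index -1 and vanishes, as does the
      constant term of a multiple of \<open>fps_X\<close>.\<close>
    by (cases d) (simp_all add: eulerian_fps_def fps_sum_nth eulerian_first_neg)
qed

text \<open>On coefficients, this is multiplication of
  \<open>j ^ (l - 1) * (j + 1) ^ (n - l)\<close> by \<open>1 = (j + 1) - j\<close>.\<close>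

lemma power_fps_diff:
  assumes "1 \<le> l" "l \<le> n"
  shows "power_fps n l = power_fps (Suc n) l - power_fps (Suc n) (Suc l)"
proof (rule fps_ext)
  fix j
  obtain m where m: "l = Suc m"
    using assms by (cases l) auto
  moreover have "n - m = Suc (n - Suc m)"
    using assms m by simp
  ultimately show "power_fps n l $ j = (power_fps (Suc n) l - power_fps (Suc n) (Suc l)) $ j"
    by (simp add: power_fps_def algebra_simps)
qed

lemma sum_power_fps:
  assumes "1 \<le> a" "a \<le> b" "b \<le> Suc n"
  shows "(\<Sum>l=a..<b. power_fps n l) = power_fps (Suc n) a - power_fps (Suc n) b"
proof -
  have "(\<Sum>l=a..<b. power_fps n l) =
      (\<Sum>l=a..<b. (- power_fps (Suc n) (Suc l)) - (- power_fps (Suc n) l))"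
    using assms by (intro sum.cong) (auto simp: power_fps_diff[of _ n])
  then show ?thesis
    using sum_Suc_diff'[OF assms(2), of "\<lambda>l. - power_fps (Suc n) l"] by simp
qed

text \<open>The coefficients are \<open>(j + 1) ^ n\<close> and \<open>j ^ n\<close>, so multiplying
  by \<open>fps_X\<close> aligns them; at index 0 this needs \<open>0 ^ n = 0\<close>, hence
  \<open>n \<ge> 1\<close>.\<close>

lemma power_fps_shift:
  "n \<ge> 1 \<Longrightarrow> fps_X * power_fps (Suc n) 1 = power_fps (Suc n) (Suc n)"
proof (rule fps_ext)
  fix j
  assume "n \<ge> 1"
  then show "(fps_X * power_fps (Suc n) 1) $ j = power_fps (Suc n) (Suc n) $ j"
    by (cases j) (simp_all add: power_fps_def add.commute)
qed

text \<open>After telescoping, the end terms \<open>fps_X * power_fps (Suc n) 1\<close> and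
  \<open>power_fps (Suc n) (Suc n)\<close> cancel, and only multiples of
  \<open>power_fps (Suc n) k\<close> remain.\<close>

lemma power_fps_Suc:
  assumes "n \<ge> 1" "k \<in> {1..Suc n}"
  shows "fps_X * (\<Sum>l=1..<k. power_fps n l) + (\<Sum>l=k..<Suc n. power_fps n l) =
    (1 - fps_X) * power_fps (Suc n) k"
proof -
  have "(\<Sum>l=1..<k. power_fps n l) = power_fps (Suc n) 1 - power_fps (Suc n) k"
    and "(\<Sum>l=k..<Suc n. power_fps n l) = power_fps (Suc n) k - power_fps (Suc n) (Suc n)"
    using assms by (intro sum_power_fps; simp)+
  then show ?thesis
    using power_fps_shift[OF assms(1)] by (simp only: right_diff_distrib left_diff_distrib) simp
qed

lemma eulerian_fps_eq:
  "n \<ge> 1 \<Longrightarrow> k \<in> {1..n} \<Longrightarrow> eulerian_fps n k = (1 - fps_X) ^ n * power_fps n k"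
proof (induction n arbitrary: k rule: nat_induct_at_least)
  case base
  then have "k = 1"
    by simp
  then show ?case
    \<comment> \<open>Here \<open>power_fps 1 1\<close> is the geometric series (with
      \<open>0 ^ 0 = 1\<close>), whose product with \<open>1 - fps_X\<close> is 1.\<close>
    using eulerian_first_1
    by (intro fps_ext) (auto simp: eulerian_fps_def power_fps_def left_diff_distrib)
next
  case (Suc n)
  have "eulerian_fps (Suc n) k =
      fps_X * (\<Sum>l=1..<k. (1 - fps_X) ^ n * power_fps n l) +
      (\<Sum>l=k..<Suc n. (1 - fps_X) ^ n * power_fps n l)"
    using Suc by (simp add: eulerian_fps_Suc)
  also have "\<dots> = (1 - fps_X) ^ n *
      (fps_X * (\<Sum>l=1..<k. power_fps n l) + (\<Sum>l=k..<Suc n. power_fps n l))"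
    by (simp add: sum_distrib_left[symmetric] distrib_left mult.left_commute)
  also have "\<dots> = (1 - fps_X) ^ Suc n * power_fps (Suc n) k"
    using power_fps_Suc[OF Suc.hyps Suc.prems] by (simp add: mult_ac)
  finally show ?case .
qed

section \<open>Extracting coefficients\<close>

lemma fps_nth_one_minus_X_power:
  "((1 - fps_X :: 'a :: comm_ring_1 fps) ^ n) $ i = (- 1) ^ i * of_nat (n choose i)"
proof (induction n arbitrary: i)
  case (Suc n)
  then show ?case
    by (cases i) (simp_all add: left_diff_distrib algebra_simps)
qed (auto simp: fps_one_nth binomial_eq_0)

theorem theorem1:
  fixes n k :: nat and d :: int
  assumes "n \<ge> 1" and "1 \<le> k" and "k \<le> n"
  shows "real (eulerian_first n d k) =
    (\<Sum>j::nat. (- 1) powi (d - int j) * real (int_choose n (d - int j))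
                * real j ^ (k - 1) * (real j + 1) ^ (n - k))"
proof (cases "d < 0")
  case True
  then show ?thesis
    \<comment> \<open>Every lower index \<open>d - int j\<close> is negative, so the series vanishes
      termwise.\<close>
    by (simp add: eulerian_first_neg int_choose_def)
next
  case False
  then obtain e where e: "d = int e"
    using nonneg_int_cases by (metis not_less)
  let ?f = "\<lambda>j. (- 1) powi (d - int j) * real (int_choose n (d - int j))
                * real j ^ (k - 1) * (real j + 1) ^ (n - k)"
  \<comment> \<open>The factors are swapped so that the convolution index \<open>j\<close> belongs
    to \<open>power_fps n k\<close>.\<close>
  have "real (eulerian_first n d k) = (power_fps n k * (1 - fps_X) ^ n) $ e"
    using eulerian_fps_eq[of n k] assms
    by (simp add: eulerian_fps_def e fps_eq_iff mult.commute)
  also have "\<dots> = (\<Sum>j=0..e. ?f j)"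
    unfolding fps_mult_nth
  proof (rule sum.cong)
    fix j assume "j \<in> {0..e}"
    \<comment> \<open>A nonnegative exponent turns \<open>powi\<close> into an ordinary power and
      \<open>int_choose\<close> into \<open>choose\<close>.\<close>
    then have "d - int j = int (e - j)"
      by (simp add: e of_nat_diff)
    then show "power_fps n k $ j * (1 - fps_X) ^ n $ (e - j) = ?f j"
      by (simp add: int_choose_def power_fps_def fps_nth_one_minus_X_power mult_ac)
  qed simp
  also have "\<dots> = (\<Sum>j. ?f j)"
    \<comment> \<open>Terms with \<open>j > e\<close> have a negative lower index and are 0, so the
      infinite sum is finite.\<close>
    by (rule suminf_finite[symmetric]) (auto simp: e int_choose_def)
  finally show ?thesis .
qed

end
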